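(* Let $\mathcal{E}\in\mathcal{C}(\mathbb{R}^d)$ attain its infimum at $v^*\in\mathbb{R}^d$, with $\mathcal{E}(v^* )=\inf_{v\in\mathbb{R}^d}\mathcal{E}(v)=0$, and suppose there exist $\mathcal{E}_\infty,R_0,\eta>0$ (with $R_0=\infty$ allowed, in which case $B_{R_0}(v^* )=\mathbb{R}^d$) and $\nu\in(0,\infty)$ such that $$\|v-v^*\|_2\le\frac{\mathcal{E}(v)^\nu}{\eta}\quad\text{for all }v\in B_{R_0}(v^* ),\qquad\mathcal{E}(v)>\mathcal{E}_\infty\quad\text{for all }v\in(B_{R_0}(v^* ))^c.$$ Let $\varrho\in\mathcal{P}(\mathbb{R}^d)$ and fix $\alpha>0$. For any $r>0$ define $\mathcal{E}_r:=\sup_{v\in B_r(v^* )}\mathcal{E}(v)$. Then for any $r\in(0,R_0]$ and $q>0$ such that $q+\mathcal{E}_r\le\mathcal{E}_\infty$, $$\|v_\alpha(\varrho)-v^*\|_2\le\frac{(q+\mathcal{E}_r)^\nu}{\eta}+\frac{\exp(-\alpha q)}{\varrho(B_r(v^* ))}\int\|v-v^*\|_2\,d\varrho(v).$$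
   Context: $\|\cdot\|_2$ is the Euclidean norm, $B_r(u)=\{v\in\mathbb{R}^d:\|v-u\|_2\le r\}$, $\mathcal{P}(\mathbb{R}^d)$ the Borel probability measures on $\mathbb{R}^d$, and $r$ is a finite real number. The consensus point is $v_\alpha(\varrho):=\int v\,\frac{\omega_\alpha(v)}{\|\omega_\alpha\|_{L_1(\varrho)}}\,d\varrho(v)$ with $\omega_\alpha(v):=\exp(-\alpha\mathcal{E}(v))$ and $\|\omega_\alpha\|_{L_1(\varrho)}=\int\omega_\alpha\,d\varrho$. The right-hand side of the inequality is read as $+\infty$ (and the inequality as void) if $\varrho(B_r(v^* ))=0$ or if $\int\|v-v^*\|_2\,d\varrho(v)=\infty$. *)

theory Defs
  imports "HOL-Probability.Probability"
begin

text \<open>Closed ball whose radius may be infinite; for a real radius it is \<^term>\<open>cball c r\<close>.\<close>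

definition ecball :: "'a::real_normed_vector \<Rightarrow> ereal \<Rightarrow> 'a set" where
  "ecball c R = {v. ereal (norm (v - c)) \<le> R}"

lemma ecball_ereal: "ecball c (ereal r) = cball c r"
  by (auto simp: ecball_def dist_norm norm_minus_commute)

lemma ecball_infinity: "ecball c \<infinity> = UNIV"
  by (simp add: ecball_def)

definition gibbs_weight :: "real \<Rightarrow> ('a \<Rightarrow> real) \<Rightarrow> 'a \<Rightarrow> real" where
  "gibbs_weight \<alpha> E v = exp (- \<alpha> * E v)"

text \<open>The weight is positive, so its integral is its L1 norm. The Bochner integrals are
  genuine whenever the objective is continuous and nonnegative, \<open>\<alpha> > 0\<close> and the
  probability measure has finite first moment.\<close>

definition consensus_point ::
    "real \<Rightarrow> ('a::euclidean_space \<Rightarrow> real) \<Rightarrow> 'a measure \<Rightarrow> 'a" where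
  "consensus_point \<alpha> E \<rho> =
     (\<integral>v. (gibbs_weight \<alpha> E v / (\<integral>w. gibbs_weight \<alpha> E w \<partial>\<rho>)) *\<^sub>R v \<partial>\<rho>)"

text \<open>The objective is continuous in all uses, hence bounded on the compact ball, so for
  \<open>r \<ge> 0\<close> this real supremum is the actual one.\<close>

definition ball_sup :: "('a::euclidean_space \<Rightarrow> real) \<Rightarrow> 'a \<Rightarrow> real \<Rightarrow> real" where
  "ball_sup E c r = (SUP v\<in>cball c r. E v)"

text \<open>In \<^typ>\<open>ennreal\<close>, \<open>x / 0 = \<infinity>\<close> for \<open>x > 0\<close>, but \<open>\<infinity> * 0 = 0\<close>.
  The second summand of the estimate is nevertheless infinite in both degenerate cases: the
  first moment about \<open>c\<close> cannot vanish if the ball is a null set.\<close>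

lemma degenerate_bound:
  fixes \<rho> :: "'a::euclidean_space measure"
  assumes "prob_space \<rho>" "sets \<rho> = sets borel" "0 < r"
    and "emeasure \<rho> (cball c r) = 0 \<or> (\<integral>\<^sup>+v. ennreal (norm (v - c)) \<partial>\<rho>) = \<infinity>"
  shows "ennreal (exp x) / emeasure \<rho> (cball c r) * (\<integral>\<^sup>+v. ennreal (norm (v - c)) \<partial>\<rho>) = \<infinity>"
proof -
  interpret prob_space \<rho> by fact
  have [measurable_cong]: "sets \<rho> = sets borel" by fact
  let ?I = "\<integral>\<^sup>+v. ennreal (norm (v - c)) \<partial>\<rho>"
  have I0: "?I \<noteq> 0" if z: "emeasure \<rho> (cball c r) = 0"
  proof
    assume "?I = 0"
    then have "AE v in \<rho>. v = c"
      by (subst (asm) nn_integral_0_iff_AE) (auto simp: ennreal_eq_0_iff)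
    then have "AE v in \<rho>. v \<in> cball c r"
      by eventually_elim (use assms(3) in auto)
    moreover have "AE v in \<rho>. v \<notin> cball c r"
      using z by (intro AE_not_in) (auto simp: null_sets_def assms(2))
    ultimately have "AE v in \<rho>. False" by eventually_elim auto
    then show False by simp
  qed
  have "ennreal (exp x) / emeasure \<rho> (cball c r) \<noteq> 0"
    by (simp add: ennreal_divide_eq_0_iff ennreal_eq_0_iff not_le emeasure_finite)
  then show ?thesis
    using assms(4) I0 by (auto simp: ennreal_top_mult ennreal_mult_top ennreal_divide_zero)
qed

end

theory Submission
  imports Defs
begin

text \<open>Write \<open>S = q + \<E>\<^sub>r\<close> and \<open>B\<close> for the ball of radius \<open>r\<close>. Since the normalised weight
  \<open>p = \<omega>\<^sub>\<alpha> / \<parallel>\<omega>\<^sub>\<alpha>\<parallel>\<close> has integral one, the error is at most \<open>\<integral> p(v) \<parallel>v - v\<^sup>*\<parallel> d\<rho>\<close>. Where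
  \<open>\<E>(v) \<le> S\<close>, the inverse continuity bounds \<open>\<parallel>v - v\<^sup>*\<parallel>\<close> by \<open>S\<^sup>\<nu> / \<eta>\<close>. Where \<open>\<E>(v) > S\<close>, the weight is
  below \<open>exp (- \<alpha> S)\<close> while its integral is at least \<open>exp (- \<alpha> \<E>\<^sub>r) \<rho>(B)\<close>, so
  \<open>p(v) \<le> exp (- \<alpha> q) / \<rho>(B)\<close>.\<close>

lemma le_ball_sup:
  fixes E :: "'a::euclidean_space \<Rightarrow> real"
  assumes "continuous_on UNIV E" "v \<in> cball c r"
  shows "E v \<le> ball_sup E c r"
proof -
  have "compact (E ` cball c r)"
    using assms(1) continuous_on_subset by (intro compact_continuous_image) auto
  then have "bdd_above (E ` cball c r)"
    by (intro bounded_imp_bdd_above compact_imp_bounded)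
  then show ?thesis
    unfolding ball_sup_def using assms(2) by (rule cSUP_upper2) simp
qed

text \<open>The nondegenerate case, in real arithmetic. Both conditions on \<open>E\<close> near and
  far from the minimiser are condensed into \<open>sublevel\<close>, so that neither
  \<open>R0\<close> nor the exponent appears; \<open>D\<close> later becomes
  \<open>?S powr \<nu> / \<eta>\<close>.\<close>

lemma consensus_point_error_le:
  fixes E :: "'a::euclidean_space \<Rightarrow> real"
  assumes "prob_space \<rho>" and sets: "sets \<rho> = sets borel"
    and cont: "continuous_on UNIV E" and nonneg: "\<And>v. 0 \<le> E v" and "0 < \<alpha>"
    and int_dist: "integrable \<rho> (\<lambda>v. norm (v - c))"
    and ball: "0 < measure \<rho> (cball c r)"
    and sublevel: "\<And>v. E v \<le> q + ball_sup E c r \<Longrightarrow> norm (v - c) \<le> D"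
    and "0 \<le> D"
  shows "norm (consensus_point \<alpha> E \<rho> - c)
           \<le> D + exp (- \<alpha> * q) / measure \<rho> (cball c r) * (\<integral>v. norm (v - c) \<partial>\<rho>)"
proof -
  interpret prob_space \<rho> by fact
  have [measurable_cong]: "sets \<rho> = sets borel" by fact
  have [measurable]: "E \<in> borel_measurable borel"
    using cont by (rule borel_measurable_continuous_onI)
  define w where "w = gibbs_weight \<alpha> E"
  define Z where "Z = (\<integral>v. w v \<partial>\<rho>)"
  define m where "m = measure \<rho> (cball c r)"
  have w_eq: "w v = exp (- \<alpha> * E v)" for v
    by (simp add: w_def gibbs_weight_def)
  have [measurable]: "w \<in> borel_measurable borel"
    unfolding w_eq[abs_def] by measurable
  have w_pos: "0 < w v" for v by (simp add: w_eq)
  have w_le1: "w v \<le> 1" for v using nonneg[of v] \<open>0 < \<alpha>\<close> by (simp add: w_eq)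
  have int_w: "integrable \<rho> w"
    by (rule integrable_const_bound[where B = 1]) (use w_pos w_le1 in \<open>auto simp: less_imp_le\<close>)
  \<comment> \<open>Compare \<open>w\<close> with a multiple of the indicator of the ball: inside,
    \<open>E\<close> is at most its supremum; outside, the indicator vanishes and \<open>w\<close>
    is positive.\<close>
  have "exp (- \<alpha> * ball_sup E c r) * m = (\<integral>v. exp (- \<alpha> * ball_sup E c r) * indicator (cball c r) v \<partial>\<rho>)"
    by (simp add: m_def)
  also have "\<dots> \<le> Z"
    unfolding Z_def
  proof (rule integral_mono[OF _ int_w])
    show "integrable \<rho> (\<lambda>v. exp (- \<alpha> * ball_sup E c r) * indicator (cball c r) v :: real)"
      by (intro integrable_mult_right integrable_real_indicator) (auto simp: emeasure_eq_measure)
    show "exp (- \<alpha> * ball_sup E c r) * indicator (cball c r) v \<le> w v" for v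
      using le_ball_sup[OF cont, of v c r] \<open>0 < \<alpha>\<close> w_pos[of v]
      by (auto simp: indicator_def w_eq)
  qed
  finally have Z_ge: "exp (- \<alpha> * ball_sup E c r) * m \<le> Z" .
  have m: "0 < m" using ball by (simp add: m_def)
  then have "0 < exp (- \<alpha> * ball_sup E c r) * m" by simp
  with Z_ge have Z: "0 < Z" by linarith
  \<comment> \<open>As \<open>0 < w v \<le> 1\<close>, the first moment dominates.\<close>
  have int_wd: "integrable \<rho> (\<lambda>v. w v * norm (v - c))"
    by (rule Bochner_Integration.integrable_bound[OF int_dist])
       (use w_pos w_le1 in \<open>auto simp: abs_mult less_imp_le intro!: mult_left_le_one_le\<close>)
  have int_wv: "integrable \<rho> (\<lambda>v. w v *\<^sub>R (v - c))"
    by (rule Bochner_Integration.integrable_bound[OF int_wd]) (auto simp: abs_mult)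
  \<comment> \<open>Each case proves one summand to be a bound and adds the other, which is
    nonnegative. The sum holds everywhere, so the domain of integration need not be split, and
    \<open>D / Z * w v\<close> integrates to \<open>D\<close>.\<close>
  have pointwise: "(w v / Z) * norm (v - c) \<le> D / Z * w v + exp (- \<alpha> * q) / m * norm (v - c)" for v
  proof (cases "E v \<le> q + ball_sup E c r")
    case True
    then have "w v / Z * norm (v - c) \<le> w v / Z * D"
      using sublevel[of v] w_pos[of v] Z by (intro mult_left_mono) (auto simp: less_imp_le)
    moreover have "0 \<le> exp (- \<alpha> * q) / m * norm (v - c)" using m by simp
    ultimately show ?thesis by (simp add: mult.commute)
  next
    case False
    then have "w v \<le> exp (- \<alpha> * (q + ball_sup E c r))"
      using \<open>0 < \<alpha>\<close> by (simp add: w_eq)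
    \<comment> \<open>Split off exactly the lower bound \<open>Z_ge\<close> for
      \<open>Z\<close>.\<close>
    also have "\<dots> = exp (- \<alpha> * q) / m * (exp (- \<alpha> * ball_sup E c r) * m)"
      using m by (simp add: distrib_left mult_exp_exp)
    also have "\<dots> \<le> exp (- \<alpha> * q) / m * Z"
      using Z_ge m by (intro mult_left_mono) auto
    finally have "w v / Z \<le> exp (- \<alpha> * q) / m"
      using Z by (simp add: pos_divide_le_eq)
    then have "w v / Z * norm (v - c) \<le> exp (- \<alpha> * q) / m * norm (v - c)"
      by (intro mult_right_mono) auto
    moreover have "0 \<le> D / Z * w v" using \<open>0 \<le> D\<close> Z w_pos[of v] by simp
    ultimately show ?thesis by linarith
  qed
  \<comment> \<open>Centre at \<open>c\<close>: the factors \<open>w v / Z\<close> have integral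
    one, so the constant part returns \<open>c\<close>.\<close>
  have "consensus_point \<alpha> E \<rho> = (\<integral>v. (1 / Z) *\<^sub>R (w v *\<^sub>R (v - c)) + (w v / Z) *\<^sub>R c \<partial>\<rho>)"
    by (simp add: consensus_point_def flip: w_def Z_def) (simp add: algebra_simps)
  also have "\<dots> = (1 / Z) *\<^sub>R (\<integral>v. w v *\<^sub>R (v - c) \<partial>\<rho>) + c"
  proof (subst Bochner_Integration.integral_add)
    show "integrable \<rho> (\<lambda>v. (1 / Z) *\<^sub>R (w v *\<^sub>R (v - c)))"
      using int_wv by (rule integrable_scaleR_right)
    show "integrable \<rho> (\<lambda>v. (w v / Z) *\<^sub>R c)"
      using int_w by simp
    show "(\<integral>v. (1 / Z) *\<^sub>R (w v *\<^sub>R (v - c)) \<partial>\<rho>) + (\<integral>v. (w v / Z) *\<^sub>R c \<partial>\<rho>)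
        = (1 / Z) *\<^sub>R (\<integral>v. w v *\<^sub>R (v - c) \<partial>\<rho>) + c"
      using Z int_w by (simp del: scaleR_scaleR flip: Z_def)
  qed
  finally have "norm (consensus_point \<alpha> E \<rho> - c) = 1 / Z * norm (\<integral>v. w v *\<^sub>R (v - c) \<partial>\<rho>)"
    using Z by simp
  also have "\<dots> \<le> 1 / Z * (\<integral>v. w v * norm (v - c) \<partial>\<rho>)"
    using integral_norm_bound[of \<rho> "\<lambda>v. w v *\<^sub>R (v - c)"] Z w_pos
    by (intro mult_left_mono) (auto simp: less_imp_le)
  also have "\<dots> = (\<integral>v. (w v / Z) * norm (v - c) \<partial>\<rho>)"
    by (simp flip: integral_mult_right_zero)
  also have "\<dots> \<le> (\<integral>v. D / Z * w v + exp (- \<alpha> * q) / m * norm (v - c) \<partial>\<rho>)"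
    using int_w int_wd int_dist pointwise by (intro integral_mono) auto
  also have "\<dots> = D + exp (- \<alpha> * q) / m * (\<integral>v. norm (v - c) \<partial>\<rho>)"
    using int_w int_dist Z by (simp flip: Z_def)
  finally show ?thesis by (simp add: m_def)
qed

theorem proposition4p5:
  fixes E :: "real ^ 'd::finite \<Rightarrow> real"
    and vstar :: "real ^ 'd"
    and \<rho> :: "(real ^ 'd) measure"
    and R0 :: ereal
    and Einf \<eta> \<nu> \<alpha> r q :: real
  assumes E_cont: "continuous_on UNIV E"
    and vstar_min: "\<And>v. E vstar \<le> E v"
    and E_inf: "E vstar = (INF v. E v)" "(INF v. E v) = 0"
    and pos: "0 < Einf" "0 < R0" "0 < \<eta>" "0 < \<nu>"
    and inverse_cont: "\<And>v. v \<in> ecball vstar R0 \<Longrightarrow> norm (v - vstar) \<le> E v powr \<nu> / \<eta>"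
    and far: "\<And>v. v \<notin> ecball vstar R0 \<Longrightarrow> Einf < E v"
    and rho: "prob_space \<rho>" "sets \<rho> = sets borel"
    and alpha: "0 < \<alpha>"
    and r: "0 < r" "ereal r \<le> R0"
    and q: "0 < q" "q + ball_sup E vstar r \<le> Einf"
  shows "ennreal (norm (consensus_point \<alpha> E \<rho> - vstar))
           \<le> ennreal ((q + ball_sup E vstar r) powr \<nu> / \<eta>)
             + ennreal (exp (- \<alpha> * q)) / emeasure \<rho> (cball vstar r)
               * (\<integral>\<^sup>+v. ennreal (norm (v - vstar)) \<partial>\<rho>)"
proof -
  interpret prob_space \<rho> by fact
  have [measurable_cong]: "sets \<rho> = sets borel" by fact
  let ?m = "measure \<rho> (cball vstar r)"
  let ?I = "\<integral>\<^sup>+v. ennreal (norm (v - vstar)) \<partial>\<rho>"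
  let ?J = "\<integral>v. norm (v - vstar) \<partial>\<rho>"
  let ?S = "q + ball_sup E vstar r"
  show ?thesis
  \<comment> \<open>In the degenerate case the right-hand side is infinite; otherwise every quantity
    in the estimate is finite and the real-valued bound applies.\<close>
  proof (cases "emeasure \<rho> (cball vstar r) = 0 \<or> ?I = \<infinity>")
    case True
    show ?thesis
      unfolding degenerate_bound[OF rho r(1) True] by simp
  next
    case False
    then have m: "0 < ?m"
      by (simp add: emeasure_eq_measure zero_less_measure_iff)
    have int_dist: "integrable \<rho> (\<lambda>v. norm (v - vstar))"
      using False by (intro integrableI_nonneg) (auto simp: top.not_eq_extremum)
    have nonneg: "0 \<le> E v" for v
      using vstar_min[of v] E_inf by simp
    have "norm (v - vstar) \<le> ?S powr \<nu> / \<eta>" if "E v \<le> ?S" for v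
    proof -
      \<comment> \<open>Outside this ball \<open>E v\<close> would exceed \<open>Einf\<close>, which
        is at least \<open>?S\<close>.\<close>
      have "v \<in> ecball vstar R0"
        using far[of v] that q(2) by force
      then have "norm (v - vstar) \<le> E v powr \<nu> / \<eta>" by (rule inverse_cont)
      also have "\<dots> \<le> ?S powr \<nu> / \<eta>"
        using that nonneg[of v] pos by (intro divide_right_mono powr_mono2) auto
      finally show ?thesis .
    qed
    then have "norm (consensus_point \<alpha> E \<rho> - vstar)
        \<le> ?S powr \<nu> / \<eta> + exp (- \<alpha> * q) / ?m * ?J"
      using pos by (intro consensus_point_error_le rho E_cont nonneg alpha int_dist m) auto
    then have "ennreal (norm (consensus_point \<alpha> E \<rho> - vstar))
        \<le> ennreal (?S powr \<nu> / \<eta> + exp (- \<alpha> * q) / ?m * ?J)"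
      by (rule ennreal_leI)
    \<comment> \<open>Nonnegativity of the summands, \<open>0 < ?m\<close> and integrability let
      \<open>ennreal\<close> pass through the sum, the quotient and the integral.\<close>
    also have "\<dots> = ennreal (?S powr \<nu> / \<eta>) + ennreal (exp (- \<alpha> * q)) / emeasure \<rho> (cball vstar r) * ?I"
      using pos m int_dist
      by (simp add: nn_integral_eq_integral emeasure_eq_measure divide_ennreal ennreal_mult''
            del: times_divide_eq_left)
    finally show ?thesis .
  qed
qed

end
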